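(* Let $\{\Phi_n, n\ge 0\}$ be a Markov chain on $\mathsf{X}$. Let $f : \mathsf{X} \to [1,\infty)$ and $n : \mathsf{X} \to \{1,2,\dots\}$ be measurable functions and let $\{r(k), k\geq 0\}$ be a non-negative sequence. Assume that there exist measurable functions $V_k, S_k : \mathsf{X} \to [1, \infty)$, $k\geq 0$, and a measurable set $\mathcal{C}$ such that for any $k \geq 0$ and $x \in \mathsf{X}$, $$\mathbb{E}_x \left[ V_{k + n(\Phi_0)}(\Phi_{n(\Phi_0)})\right] \leq V_k(x) - \mathbb{E}_x \left[\sum_{j=0}^{n(\Phi_0)-1} r(k+j) f(\Phi_j)\right] + S_k(x)\, \mathbf{1}_{\mathcal{C}}(x).$$ Then for any $x \in \mathsf{X}$, $$\mathbb{E}_x \left[ \sum_{k=0}^{\tau_{\mathcal{C}} -1} r(k) \, f(\Phi_k) \right] \leq V_0(x) + S_0(x) \, \mathbf{1}_{\mathcal{C}}(x).$$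
   Context: The chain is time-homogeneous on a general state space $\mathsf{X}$; $\mathbb{E}_x$ is expectation for the chain started at $\Phi_0=x$; $\tau_{\mathcal{C}} := \inf\{k\ge 1 : \Phi_k\in\mathcal{C}\}$ is the first return time to $\mathcal{C}$ (possibly $+\infty$); $\mathbf{1}_{\mathcal{C}}$ is the indicator function. *)

theory Defs
  imports "HOL-Probability.Probability"
begin

text \<open>The sigma-algebra generated by \<open>\<Phi> 0, \<dots>, \<Phi> m\<close>.\<close>

definition history :: "'w measure \<Rightarrow> 'a measure \<Rightarrow> (nat \<Rightarrow> 'w \<Rightarrow> 'a) \<Rightarrow> nat \<Rightarrow> 'w measure" where
  "history M X \<Phi> m = sigma (space M) {\<Phi> i -` A \<inter> space M | i A. i \<le> m \<and> A \<in> sets X}"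

text \<open>
  \<open>P x\<close> is the law under which the chain is started at \<open>x\<close>, and \<open>K\<close> is the one-step transition
  kernel. The initial condition is expressed as \<open>\<Phi> 0\<close> having the Dirac distribution at \<open>x\<close>,
  because singletons need not be measurable in a general state space.
\<close>

locale time_homogeneous_markov_chain =
  fixes X :: "'a measure"
    and K :: "'a \<Rightarrow> 'a measure"
    and P :: "'a \<Rightarrow> 'w measure"
    and \<Phi> :: "nat \<Rightarrow> 'w \<Rightarrow> 'a"
  assumes kernel: "K \<in> X \<rightarrow>\<^sub>M prob_algebra X"
    and prob_space_P: "\<And>x. x \<in> space X \<Longrightarrow> prob_space (P x)"
    and measurable_chain: "\<And>x m. x \<in> space X \<Longrightarrow> \<Phi> m \<in> P x \<rightarrow>\<^sub>M X"
    and initial: "\<And>x. x \<in> space X \<Longrightarrow> distr (P x) X (\<Phi> 0) = return X x"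
    and markov_property: "\<And>x m A. x \<in> space X \<Longrightarrow> A \<in> sets X \<Longrightarrow>
      AE \<omega> in P x.
        nn_cond_exp (P x) (history (P x) X \<Phi> m) (\<lambda>\<omega>'. indicator A (\<Phi> (Suc m) \<omega>')) \<omega>
          = emeasure (K (\<Phi> m \<omega>)) A"

text \<open>The infimum of the empty set in \<^typ>\<open>enat\<close> is \<open>\<infinity>\<close>.\<close>

definition return_time :: "(nat \<Rightarrow> 'w \<Rightarrow> 'a) \<Rightarrow> 'a set \<Rightarrow> 'w \<Rightarrow> enat" where
  "return_time \<Phi> C \<omega> = Inf {enat k | k. 1 \<le> k \<and> \<Phi> k \<omega> \<in> C}"

end

theory Submission
  imports Defs
begin

text \<open>
  Let \<open>Q\<close> be the transition operator killed on \<open>C\<close>, \<open>Q g x = E\<^sub>x[g(\<Phi>\<^sub>1); \<Phi>\<^sub>1 \<notin> C]\<close>. By the Markov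
  property \<open>Q\<^sup>j g x = E\<^sub>x[g(\<Phi>\<^sub>j); j < \<tau>\<^sub>C]\<close>, so the claim is
  \<open>\<Sum>j<N. r(k + j) Q\<^sup>j f \<le> V\<^sub>k + S\<^sub>k 1\<^sub>C\<close> for all \<open>N\<close> at \<open>k = 0\<close>; it is proved for all \<open>k\<close>
  by strong induction on \<open>N\<close>. Given \<open>x\<close> and \<open>n = n(x) \<ge> 1\<close>, the first \<open>n\<close> terms are at most
  \<open>E\<^sub>x[\<Sum>j<n. r(k + j) f(\<Phi>\<^sub>j)]\<close>; the remaining ones are at most
  \<open>E\<^sub>x[\<Sum>j<N-n. r(k + n + j) Q\<^sup>j f(\<Phi>\<^sub>n); \<Phi>\<^sub>n \<notin> C]\<close>, which by the induction hypothesis, where the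
  term \<open>S 1\<^sub>C\<close> vanishes off \<open>C\<close>, is at most \<open>E\<^sub>x[V\<^bsub>k+n\<^esub>(\<Phi>\<^sub>n)]\<close>. The drift condition closes the
  induction.
\<close>

section \<open>Return time and natural filtration\<close>

lemma less_return_time_iff:
  "enat k < return_time \<Phi> C \<omega> \<longleftrightarrow> (\<forall>i\<in>{1..k}. \<Phi> i \<omega> \<notin> C)"
proof
  assume *: "enat k < return_time \<Phi> C \<omega>"
  show "\<forall>i\<in>{1..k}. \<Phi> i \<omega> \<notin> C"
  proof (rule ballI, rule notI)
    fix i assume "i \<in> {1..k}" "\<Phi> i \<omega> \<in> C"
    then have "return_time \<Phi> C \<omega> \<le> enat i"
      unfolding return_time_def by (intro Inf_lower) auto
    with * \<open>i \<in> {1..k}\<close> show False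
      by (metis atLeastAtMost_iff enat_ord_simps(1) leD order_trans)
  qed
next
  assume *: "\<forall>i\<in>{1..k}. \<Phi> i \<omega> \<notin> C"
  \<comment> \<open>A strict bound on all elements need not survive the infimum, so the bound is
    shown as a weak one at \<open>Suc k\<close>.\<close>
  have "enat (Suc k) \<le> return_time \<Phi> C \<omega>"
    unfolding return_time_def
  proof (rule Inf_greatest)
    fix t assume "t \<in> {enat k | k. 1 \<le> k \<and> \<Phi> k \<omega> \<in> C}"
    then obtain i where "t = enat i" "1 \<le> i" "\<Phi> i \<omega> \<in> C" by auto
    with * show "enat (Suc k) \<le> t" by (auto simp: not_less_eq_eq)
  qed
  then show "enat k < return_time \<Phi> C \<omega>"
    using Suc_ile_eq by blast
qed

text \<open>Product form of the survival event, whose last factor can be split off in an induction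
  on time. The product starts at 1, as the return time ignores time 0; for \<open>k = 0\<close> it
  is empty and equals 1.\<close>

lemma indicator_less_return_time:
  "indicator {k. enat k < return_time \<Phi> C \<omega>} k = (\<Prod>i=1..k. indicator (- C) (\<Phi> i \<omega>) :: ennreal)"
  unfolding indicator_def less_return_time_iff by (auto simp: less_return_time_iff prod_zero_iff)

lemma measurable_history:
  assumes "\<And>j. \<Phi> j \<in> M \<rightarrow>\<^sub>M X" and "i \<le> m"
  shows "\<Phi> i \<in> history M X \<Phi> m \<rightarrow>\<^sub>M X"
proof (rule measurableI)
  fix \<omega> assume "\<omega> \<in> space (history M X \<Phi> m)"
  then show "\<Phi> i \<omega> \<in> space X"
    using assms(1)[THEN measurable_space] by (simp add: history_def space_measure_of_conv)
next
  fix A assume "A \<in> sets X"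
  then have "\<Phi> i -` A \<inter> space M \<in> {\<Phi> i -` A \<inter> space M | i A. i \<le> m \<and> A \<in> sets X}"
    using assms(2) by blast
  then show "\<Phi> i -` A \<inter> space (history M X \<Phi> m) \<in> sets (history M X \<Phi> m)"
    unfolding history_def by (subst space_measure_of, blast) (rule in_measure_of, blast)
qed

lemma subalgebra_history:
  assumes "\<And>j. \<Phi> j \<in> M \<rightarrow>\<^sub>M X"
  shows "subalgebra M (history M X \<Phi> m)"
proof -
  have "{\<Phi> i -` A \<inter> space M | i A. i \<le> m \<and> A \<in> sets X} \<subseteq> sets M"
    using measurable_sets[OF assms] by blast
  then show ?thesis
    unfolding subalgebra_def history_def
    by (simp add: sets.sigma_sets_subset space_measure_of_conv sets.space_closed
        sets_measure_of[OF order_trans[OF _ sets.space_closed]])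
qed

text \<open>\<open>- C\<close> is the complement in the whole type and need not lie in
  \<open>sets X\<close>; measurability depends only on its trace on \<open>space X\<close>.\<close>

lemma measurable_indicator_Compl:
  assumes "C \<in> sets X"
  shows "indicator (- C) \<in> borel_measurable X"
proof -
  have "- C \<inter> space X = space X - C" by auto
  with assms show ?thesis by (simp add: borel_measurable_indicator_iff)
qed

section \<open>Killed transition operator and Markov property\<close>

context time_homogeneous_markov_chain
begin

text \<open>Killing acts on the arrival point only, so the starting point may lie in
  \<open>C\<close>.\<close>

definition killed :: "'a set \<Rightarrow> ('a \<Rightarrow> ennreal) \<Rightarrow> 'a \<Rightarrow> ennreal" where
  "killed C g x = (\<integral>\<^sup>+ y. indicator (- C) y * g y \<partial>K x)"

lemma measurable_kernel: "K \<in> X \<rightarrow>\<^sub>M subprob_algebra X"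
  using kernel by (rule measurable_prob_algebraD)

lemma measurable_killed:
  assumes "C \<in> sets X" and [measurable]: "g \<in> borel_measurable X"
  shows "killed C g \<in> borel_measurable X"
proof -
  note [measurable] = measurable_indicator_Compl[OF assms(1)]
  show ?thesis
    unfolding killed_def
    by (rule nn_integral_measurable_subprob_algebra2[OF _ measurable_kernel]) measurable
qed

lemma measurable_killed_funpow:
  assumes "C \<in> sets X" "g \<in> borel_measurable X"
  shows "(killed C ^^ j) g \<in> borel_measurable X"
  by (induction j) (auto intro: measurable_killed assms)

lemma AE_initial:
  assumes x: "x \<in> space X" and A: "{y \<in> space X. R y} \<in> sets X" and "R x"
  shows "AE \<omega> in P x. R (\<Phi> 0 \<omega>)"
proof -
  have "AE y in distr (P x) X (\<Phi> 0). R y"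
    unfolding initial[OF x] using assms by (simp add: AE_return)
  then show ?thesis
    by (subst (asm) AE_distr_iff) (use measurable_chain[OF x] A in auto)
qed

text \<open>The Markov property is assumed for indicators only. It extends to all nonnegative
  \<open>g\<close> at once by comparing measures: weighted by the density \<open>h\<close>, the law
  of the next state is the law of the present state pushed through \<open>K\<close>.\<close>

lemma nn_integral_markov:
  assumes x: "x \<in> space X"
    and h: "h \<in> borel_measurable (history (P x) X \<Phi> m)"
    and g: "g \<in> borel_measurable X"
  shows "(\<integral>\<^sup>+\<omega>. h \<omega> * g (\<Phi> (Suc m) \<omega>) \<partial>P x)
       = (\<integral>\<^sup>+\<omega>. h \<omega> * (\<integral>\<^sup>+ y. g y \<partial>K (\<Phi> m \<omega>)) \<partial>P x)"
proof -
  note chain = measurable_chain[OF x]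
  interpret prob_space "P x" using prob_space_P[OF x] .
  interpret sub: finite_measure_subalgebra "P x" "history (P x) X \<Phi> m"
    by unfold_locales (rule subalgebra_history[OF chain])
  have [measurable]: "h \<in> borel_measurable (P x)"
    using h sub.subalg measurable_from_subalg by blast
  note [measurable] = chain g measurable_kernel
  let ?D = "density (P x) h"
  have [measurable]: "\<Phi> i \<in> ?D \<rightarrow>\<^sub>M X" for i by simp
  have "distr ?D X (\<Phi> (Suc m)) = distr ?D X (\<Phi> m) \<bind> K"
  proof (rule measure_eqI)
    have ne: "space X \<noteq> {}" using x by auto
    then show "sets (distr ?D X (\<Phi> (Suc m))) = sets (distr ?D X (\<Phi> m) \<bind> K)"
      using sets_kernel[OF measurable_kernel] by (subst sets_bind[where N=X]) auto
    fix A assume "A \<in> sets (distr ?D X (\<Phi> (Suc m)))"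
    then have A[measurable]: "A \<in> sets X" by simp
    have *: "AE \<omega> in P x. nn_cond_exp (P x) (history (P x) X \<Phi> m)
        (\<lambda>\<omega>'. indicator A (\<Phi> (Suc m) \<omega>')) \<omega> = emeasure (K (\<Phi> m \<omega>)) A"
      by (rule markov_property[OF x A])
    have "emeasure (distr ?D X (\<Phi> (Suc m))) A
        = (\<integral>\<^sup>+ y. indicator A y \<partial>distr ?D X (\<Phi> (Suc m)))"
      by simp
    also have "\<dots> = (\<integral>\<^sup>+\<omega>. h \<omega> * indicator A (\<Phi> (Suc m) \<omega>) \<partial>P x)"
      by (subst nn_integral_distr) (auto simp: nn_integral_density)
    also have "\<dots> = (\<integral>\<^sup>+\<omega>. h \<omega> * nn_cond_exp (P x) (history (P x) X \<Phi> m)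
        (\<lambda>\<omega>'. indicator A (\<Phi> (Suc m) \<omega>')) \<omega> \<partial>P x)"
      \<comment> \<open>Defining property of conditional expectation, applicable because
        \<open>h\<close> is measurable for the history up to \<open>m\<close>.\<close>
      by (rule sub.nn_cond_exp_intg[symmetric]) (use h in measurable)
    also have "\<dots> = (\<integral>\<^sup>+\<omega>. h \<omega> * emeasure (K (\<Phi> m \<omega>)) A \<partial>P x)"
      using * by (intro nn_integral_cong_AE) auto
    also have "\<dots> = (\<integral>\<^sup>+ y. emeasure (K y) A \<partial>distr ?D X (\<Phi> m))"
      by (subst nn_integral_distr) (auto simp: nn_integral_density)
    also have "\<dots> = emeasure (distr ?D X (\<Phi> m) \<bind> K) A"
      by (rule emeasure_bind[symmetric, where N=X]) (use ne in auto)
    finally show "emeasure (distr ?D X (\<Phi> (Suc m))) A = emeasure (distr ?D X (\<Phi> m) \<bind> K) A" .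
  qed
  then have "(\<integral>\<^sup>+ y. g y \<partial>distr ?D X (\<Phi> (Suc m))) = (\<integral>\<^sup>+ z. \<integral>\<^sup>+ y. g y \<partial>K z \<partial>distr ?D X (\<Phi> m))"
    by (simp add: nn_integral_bind[where B=X])
  moreover have "(\<lambda>z. \<integral>\<^sup>+ y. g y \<partial>K z) \<in> borel_measurable X"
    by (rule nn_integral_measurable_subprob_algebra2) measurable
  ultimately show ?thesis
    by (simp add: nn_integral_distr nn_integral_density)
qed

text \<open>Conditioning on the past up to \<open>m\<close> replaces \<open>g\<close> at time
  \<open>m + 1\<close> by \<open>killed C g\<close> at time \<open>m\<close>. The test function thus
  changes along the induction, which is why \<open>g\<close> is arbitrary.\<close>

lemma nn_integral_killed_funpow:
  assumes x: "x \<in> space X" and C: "C \<in> sets X" and g: "g \<in> borel_measurable X"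
  shows "(\<integral>\<^sup>+\<omega>. (\<Prod>i=1..m. indicator (- C) (\<Phi> i \<omega>)) * g (\<Phi> m \<omega>) \<partial>P x) = (killed C ^^ m) g x"
  using g
proof (induction m arbitrary: g)
  case 0
  have "(\<integral>\<^sup>+\<omega>. g (\<Phi> 0 \<omega>) \<partial>P x) = (\<integral>\<^sup>+ y. g y \<partial>distr (P x) X (\<Phi> 0))"
    using measurable_chain[OF x] 0 by (simp add: nn_integral_distr)
  then show ?case
    using x 0 by (simp add: initial nn_integral_return)
next
  case (Suc m)
  note ind[measurable] = measurable_indicator_Compl[OF C, where 'b = ennreal]
  note [measurable] = Suc.prems
  have h: "(\<lambda>\<omega>. \<Prod>i=1..m. indicator (- C) (\<Phi> i \<omega>) :: ennreal)
      \<in> borel_measurable (history (P x) X \<Phi> m)"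
    by (intro borel_measurable_prod_ennreal measurable_compose[OF measurable_history ind]
        measurable_chain x) auto
  have "(\<integral>\<^sup>+\<omega>. (\<Prod>i=1..Suc m. indicator (- C) (\<Phi> i \<omega>)) * g (\<Phi> (Suc m) \<omega>) \<partial>P x)
      = (\<integral>\<^sup>+\<omega>. (\<Prod>i=1..m. indicator (- C) (\<Phi> i \<omega>))
          * (indicator (- C) (\<Phi> (Suc m) \<omega>) * g (\<Phi> (Suc m) \<omega>)) \<partial>P x)"
    by (simp add: mult.assoc)
  also have "\<dots> = (\<integral>\<^sup>+\<omega>. (\<Prod>i=1..m. indicator (- C) (\<Phi> i \<omega>)) * killed C g (\<Phi> m \<omega>) \<partial>P x)"
    unfolding killed_def by (rule nn_integral_markov[OF x h]) measurable
  also have "\<dots> = (killed C ^^ m) (killed C g) x"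
    by (rule Suc.IH) (rule measurable_killed[OF C Suc.prems])
  also have "\<dots> = (killed C ^^ Suc m) g x"
    by (simp only: funpow_Suc_right o_apply)
  finally show ?case .
qed

section \<open>Bounds on killed expectations and the drift induction\<close>

lemma killed_funpow_le:
  assumes x: "x \<in> space X" and C: "C \<in> sets X" and g: "g \<in> borel_measurable X"
  shows "(killed C ^^ m) g x \<le> (\<integral>\<^sup>+\<omega>. g (\<Phi> m \<omega>) \<partial>P x)"
  unfolding nn_integral_killed_funpow[OF assms, symmetric]
proof (rule nn_integral_mono)
  fix \<omega>
  have "(\<Prod>i=1..m. indicator (- C) (\<Phi> i \<omega>) :: ennreal) \<le> 1"
    by (intro prod_le_1) (auto simp: indicator_def)
  from mult_right_mono[OF this, of "g (\<Phi> m \<omega>)"]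
  show "(\<Prod>i=1..m. indicator (- C) (\<Phi> i \<omega>)) * g (\<Phi> m \<omega>) \<le> g (\<Phi> m \<omega>)"
    by simp
qed

text \<open>All survival factors but the last are bounded by 1. The last one exists because
  \<open>1 \<le> m\<close>; it later removes the \<open>S\<close> term.\<close>

lemma killed_funpow_le_outside:
  assumes x: "x \<in> space X" and C: "C \<in> sets X" and g: "g \<in> borel_measurable X" and "1 \<le> m"
  shows "(killed C ^^ m) g x \<le> (\<integral>\<^sup>+\<omega>. indicator (- C) (\<Phi> m \<omega>) * g (\<Phi> m \<omega>) \<partial>P x)"
  unfolding nn_integral_killed_funpow[OF x C g, symmetric]
proof (intro nn_integral_mono mult_right_mono)
  fix \<omega>
  show "(\<Prod>i=1..m. indicator (- C) (\<Phi> i \<omega>) :: ennreal) \<le> indicator (- C) (\<Phi> m \<omega>)"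
    using \<open>1 \<le> m\<close> by (cases "\<Phi> m \<omega> \<in> C") (auto intro!: prod_le_1 simp: indicator_def)
qed auto

text \<open>The drift is stated additively, so that \<open>ennreal\<close> subtraction never occurs.
  The index \<open>k\<close> is generalised because the induction hypothesis is used at
  \<open>k + n x\<close>.\<close>

lemma sum_killed_le:
  assumes C: "C \<in> sets X" and f: "f \<in> borel_measurable X"
    and n: "\<And>x. x \<in> space X \<Longrightarrow> 1 \<le> n x"
    and drift: "\<And>k x. x \<in> space X \<Longrightarrow>
      (\<integral>\<^sup>+\<omega>. V (k + n x) (\<Phi> (n x) \<omega>) \<partial>P x) + (\<integral>\<^sup>+\<omega>. (\<Sum>j<n x. r (k + j) * f (\<Phi> j \<omega>)) \<partial>P x)
        \<le> V k x + S k x * indicator C x"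
    and x: "x \<in> space X"
  shows "(\<Sum>j<N. r (k + j) * (killed C ^^ j) f x) \<le> V k x + S k x * (indicator C x :: ennreal)"
  using x
proof (induction N arbitrary: k x rule: less_induct)
  case (less N)
  let ?n = "n x" and ?Q = "killed C"
  note x = \<open>x \<in> space X\<close>
  note Q = measurable_killed_funpow[OF C f]
  note [measurable] = measurable_chain[OF x] f Q
  note ind[measurable] = measurable_indicator_Compl[OF C, where 'b = ennreal]
  show ?case
  proof (cases "N = 0")
    case False
    have split: "sum g {..<a + b} = sum g {..<a} + (\<Sum>j<b. g (a + j))"
      for g :: "nat \<Rightarrow> ennreal" and a b
      by (induction b) (simp_all add: add.assoc)
    \<comment> \<open>Truncated subtraction covers \<open>N < ?n\<close> too: the sum is then
      enlarged to \<open>?n\<close> terms and the second block is empty.\<close>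
    have "(\<Sum>j<N. r (k + j) * (?Q ^^ j) f x) \<le> (\<Sum>j<?n + (N - ?n). r (k + j) * (?Q ^^ j) f x)"
      by (intro sum_mono2) auto
    also have "\<dots> = (\<Sum>j<?n. r (k + j) * (?Q ^^ j) f x)
        + (\<Sum>j<N - ?n. r (k + ?n + j) * (?Q ^^ (?n + j)) f x)"
      unfolding split by (simp add: add.assoc)
    also have "\<dots> \<le> (\<integral>\<^sup>+\<omega>. (\<Sum>j<?n. r (k + j) * f (\<Phi> j \<omega>)) \<partial>P x)
        + (\<integral>\<^sup>+\<omega>. V (k + ?n) (\<Phi> ?n \<omega>) \<partial>P x)"
    proof (rule add_mono)
      have "(\<Sum>j<?n. r (k + j) * (?Q ^^ j) f x) \<le> (\<Sum>j<?n. r (k + j) * (\<integral>\<^sup>+\<omega>. f (\<Phi> j \<omega>) \<partial>P x))"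
        by (intro sum_mono mult_left_mono killed_funpow_le x C f) auto
      also have "\<dots> = (\<integral>\<^sup>+\<omega>. (\<Sum>j<?n. r (k + j) * f (\<Phi> j \<omega>)) \<partial>P x)"
        by (simp add: nn_integral_sum nn_integral_cmult)
      finally show "(\<Sum>j<?n. r (k + j) * (?Q ^^ j) f x)
          \<le> (\<integral>\<^sup>+\<omega>. (\<Sum>j<?n. r (k + j) * f (\<Phi> j \<omega>)) \<partial>P x)" .
    next
      have "(\<Sum>j<N - ?n. r (k + ?n + j) * (?Q ^^ (?n + j)) f x)
          \<le> (\<Sum>j<N - ?n. r (k + ?n + j)
              * (\<integral>\<^sup>+\<omega>. indicator (- C) (\<Phi> ?n \<omega>) * (?Q ^^ j) f (\<Phi> ?n \<omega>) \<partial>P x))"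
        \<comment> \<open>Read as \<open>?Q ^^ ?n\<close> applied to the function
          \<open>(?Q ^^ j) f\<close>, with only the killing at time \<open>?n\<close>
          retained.\<close>
        unfolding funpow_add o_apply
        by (intro sum_mono mult_left_mono killed_funpow_le_outside x C Q n) auto
      also have "\<dots> = (\<integral>\<^sup>+\<omega>. (\<Sum>j<N - ?n. r (k + ?n + j)
          * (indicator (- C) (\<Phi> ?n \<omega>) * (?Q ^^ j) f (\<Phi> ?n \<omega>))) \<partial>P x)"
        by (simp add: nn_integral_sum nn_integral_cmult)
      also have "\<dots> = (\<integral>\<^sup>+\<omega>. indicator (- C) (\<Phi> ?n \<omega>)
          * (\<Sum>j<N - ?n. r (k + ?n + j) * (?Q ^^ j) f (\<Phi> ?n \<omega>)) \<partial>P x)"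
        by (simp only: sum_distrib_left mult.left_commute)
      also have "\<dots> \<le> (\<integral>\<^sup>+\<omega>. V (k + ?n) (\<Phi> ?n \<omega>) \<partial>P x)"
      proof (rule nn_integral_mono)
        fix \<omega> assume "\<omega> \<in> space (P x)"
        then have y: "\<Phi> ?n \<omega> \<in> space X"
          using measurable_chain[OF x] measurable_space by metis
        have "N - ?n < N"
          using False n[OF x] by simp
        from less.IH[OF this y, of "k + ?n"]
        show "indicator (- C) (\<Phi> ?n \<omega>)
            * (\<Sum>j<N - ?n. r (k + ?n + j) * (?Q ^^ j) f (\<Phi> ?n \<omega>)) \<le> V (k + ?n) (\<Phi> ?n \<omega>)"
          \<comment> \<open>On \<open>C\<close> the left side is 0; off \<open>C\<close> the
            \<open>S\<close> term of the induction hypothesis is 0.\<close>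
          by (cases "\<Phi> ?n \<omega> \<in> C") auto
      qed
      finally show "(\<Sum>j<N - ?n. r (k + ?n + j) * (?Q ^^ (?n + j)) f x)
          \<le> (\<integral>\<^sup>+\<omega>. V (k + ?n) (\<Phi> ?n \<omega>) \<partial>P x)" .
    qed
    also have "\<dots> \<le> V k x + S k x * indicator C x"
      using drift[OF x, of k] by (simp add: add.commute)
    finally show ?thesis .
  qed simp
qed

lemma nn_integral_until_return_le:
  assumes x: "x \<in> space X" and C: "C \<in> sets X" and f: "f \<in> borel_measurable X"
    and bound: "\<And>N. (\<Sum>j<N. r j * (killed C ^^ j) f x) \<le> B"
  shows "(\<integral>\<^sup>+\<omega>. (\<Sum>k. r k * f (\<Phi> k \<omega>) * indicator {k. enat k < return_time \<Phi> C \<omega>} k) \<partial>P x) \<le> B"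
proof -
  note [measurable] = measurable_chain[OF x] f
  note ind[measurable] = measurable_indicator_Compl[OF C, where 'b = ennreal]
  have "(\<integral>\<^sup>+\<omega>. (\<Sum>k. r k * f (\<Phi> k \<omega>) * indicator {k. enat k < return_time \<Phi> C \<omega>} k) \<partial>P x)
      = (\<integral>\<^sup>+\<omega>. (\<Sum>k. r k * ((\<Prod>i=1..k. indicator (- C) (\<Phi> i \<omega>)) * f (\<Phi> k \<omega>))) \<partial>P x)"
    unfolding indicator_less_return_time by (simp add: mult_ac)
  also have "\<dots> = (\<Sum>k. r k * (killed C ^^ k) f x)"
    \<comment> \<open>Nonnegativity allows the series and the integral to be exchanged.\<close>
    by (simp add: nn_integral_suminf nn_integral_cmult nn_integral_killed_funpow[OF x C f, simplified])
  also have "\<dots> \<le> B"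
    using bound by (intro suminf_le_const) auto
  finally show ?thesis .
qed

end

section \<open>From the real-valued drift condition to its additive form\<close>

lemma ennreal_add_le_of_ereal_le_diff:
  assumes "enn2ereal a \<le> ereal v - enn2ereal b + ereal s" "0 \<le> v" "0 \<le> s"
  shows "a + b \<le> ennreal v + ennreal s"
  \<comment> \<open>Infinite values are contradictory: \<open>b = \<infinity>\<close> would make the
    right side \<open>-\<infinity>\<close>, below the nonnegative left side, and
    \<open>a = \<infinity>\<close> would exceed a finite bound. The rest is real
    rearrangement.\<close>
  using assms by (cases a; cases b) (simp_all flip: ennreal_plus)

theorem proposition3p1:
  fixes X :: "'a measure"
    and K :: "'a \<Rightarrow> 'a measure"
    and P :: "'a \<Rightarrow> 'w measure"
    and \<Phi> :: "nat \<Rightarrow> 'w \<Rightarrow> 'a"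
    and f :: "'a \<Rightarrow> real"
    and n :: "'a \<Rightarrow> nat"
    and r :: "nat \<Rightarrow> real"
    and V S :: "nat \<Rightarrow> 'a \<Rightarrow> real"
    and C :: "'a set"
  assumes "time_homogeneous_markov_chain X K P \<Phi>"
    and "f \<in> borel_measurable X" and "\<And>x. x \<in> space X \<Longrightarrow> 1 \<le> f x"
    and "n \<in> X \<rightarrow>\<^sub>M count_space UNIV" and "\<And>x. x \<in> space X \<Longrightarrow> 1 \<le> n x"
    and "\<And>k. 0 \<le> r k"
    and "\<And>k. V k \<in> borel_measurable X" and "\<And>k x. x \<in> space X \<Longrightarrow> 1 \<le> V k x"
    and "\<And>k. S k \<in> borel_measurable X" and "\<And>k x. x \<in> space X \<Longrightarrow> 1 \<le> S k x"
    and "C \<in> sets X"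
    and drift: "\<And>k x. x \<in> space X \<Longrightarrow>
      enn2ereal (\<integral>\<^sup>+\<omega>. ennreal (V (k + n (\<Phi> 0 \<omega>)) (\<Phi> (n (\<Phi> 0 \<omega>)) \<omega>)) \<partial>P x)
        \<le> ereal (V k x)
            - enn2ereal (\<integral>\<^sup>+\<omega>. ennreal (\<Sum>j<n (\<Phi> 0 \<omega>). r (k + j) * f (\<Phi> j \<omega>)) \<partial>P x)
            + ereal (S k x * indicator C x)"
  shows "\<forall>x\<in>space X.
      (\<integral>\<^sup>+\<omega>. (\<Sum>k. ennreal (r k * f (\<Phi> k \<omega>)) * indicator {k. enat k < return_time \<Phi> C \<omega>} k) \<partial>P x)
        \<le> ennreal (V 0 x + S 0 x * indicator C x)"
proof
  fix x assume x: "x \<in> space X"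
  interpret time_homogeneous_markov_chain X K P \<Phi> by fact
  note f = assms(2) and n = assms(4) and r = assms(6) and C = \<open>C \<in> sets X\<close>
  have f0: "0 \<le> f y" if "y \<in> space X" for y using assms(3)[OF that] by simp
  have V0: "0 \<le> V k y" if "y \<in> space X" for k y using assms(8)[OF that, of k] by simp
  have S0: "0 \<le> S k y" if "y \<in> space X" for k y using assms(10)[OF that, of k] by simp
  have drift': "(\<integral>\<^sup>+\<omega>. ennreal (V (k + n y) (\<Phi> (n y) \<omega>)) \<partial>P y)
        + (\<integral>\<^sup>+\<omega>. (\<Sum>j<n y. ennreal (r (k + j)) * ennreal (f (\<Phi> j \<omega>))) \<partial>P y)
      \<le> ennreal (V k y) + ennreal (S k y) * indicator C y" if y: "y \<in> space X" for k y
  proof -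
    \<comment> \<open>This level set is measurable and contains \<open>y\<close>, so
      \<open>n (\<Phi> 0 \<omega>)\<close> may be replaced by the constant \<open>n y\<close> almost
      surely.\<close>
    have "{z \<in> space X. n z = n y} = n -` {n y} \<inter> space X" by auto
    then have "{z \<in> space X. n z = n y} \<in> sets X"
      using measurable_sets[OF n, of "{n y}"] by simp
    then have n0: "AE \<omega> in P y. n (\<Phi> 0 \<omega>) = n y"
      by (rule AE_initial[OF y]) simp
    have fn: "0 \<le> f (\<Phi> j \<omega>)" if "\<omega> \<in> space (P y)" for j \<omega>
      using f0 measurable_space[OF measurable_chain[OF y] that] by blast
    have "(\<integral>\<^sup>+\<omega>. ennreal (V (k + n y) (\<Phi> (n y) \<omega>)) \<partial>P y)
        = (\<integral>\<^sup>+\<omega>. ennreal (V (k + n (\<Phi> 0 \<omega>)) (\<Phi> (n (\<Phi> 0 \<omega>)) \<omega>)) \<partial>P y)"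
      by (rule nn_integral_cong_AE) (use n0 in auto)
    moreover have "(\<integral>\<^sup>+\<omega>. (\<Sum>j<n y. ennreal (r (k + j)) * ennreal (f (\<Phi> j \<omega>))) \<partial>P y)
        = (\<integral>\<^sup>+\<omega>. ennreal (\<Sum>j<n y. r (k + j) * f (\<Phi> j \<omega>)) \<partial>P y)"
      by (rule nn_integral_cong) (simp add: r fn sum_ennreal flip: ennreal_mult)
    moreover have "\<dots> = (\<integral>\<^sup>+\<omega>. ennreal (\<Sum>j<n (\<Phi> 0 \<omega>). r (k + j) * f (\<Phi> j \<omega>)) \<partial>P y)"
      by (rule nn_integral_cong_AE) (use n0 in auto)
    moreover have "ennreal (S k y * indicator C y) = ennreal (S k y) * indicator C y"
      by (simp add: indicator_def)
    ultimately show ?thesis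
      using ennreal_add_le_of_ereal_le_diff[OF drift[OF y, of k]] V0[OF y] S0[OF y] by simp
  qed
  have "(\<integral>\<^sup>+\<omega>. (\<Sum>k. ennreal (r k) * ennreal (f (\<Phi> k \<omega>))
        * indicator {k. enat k < return_time \<Phi> C \<omega>} k) \<partial>P x)
      \<le> ennreal (V 0 x) + ennreal (S 0 x) * indicator C x"
  proof (rule nn_integral_until_return_le[OF x C])
    show "(\<Sum>j<N. ennreal (r j) * (killed C ^^ j) (\<lambda>y. ennreal (f y)) x)
        \<le> ennreal (V 0 x) + ennreal (S 0 x) * indicator C x" for N
      using sum_killed_le[where V="\<lambda>k y. ennreal (V k y)" and S="\<lambda>k y. ennreal (S k y)"
          and r="\<lambda>k. ennreal (r k)" and k=0, OF C _ assms(5) drift' x] f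
      by simp
  qed (use f in measurable)
  also have "\<dots> = ennreal (V 0 x + S 0 x * indicator C x)"
    using V0[OF x] S0[OF x] by (simp add: indicator_def)
  finally show "(\<integral>\<^sup>+\<omega>. (\<Sum>k. ennreal (r k * f (\<Phi> k \<omega>))
      * indicator {k. enat k < return_time \<Phi> C \<omega>} k) \<partial>P x)
    \<le> ennreal (V 0 x + S 0 x * indicator C x)"
    by (simp add: ennreal_mult' r)
qed

end
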